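(* Let $K,L\ge 0$ be integers, let $n=K+L+1$, and let $\mu=(K+1,1^L)$. Then the set ${\cal D}$ of drawings with crosses associated to $\mu$ has cardinality $n!$.
   Context: Here $\mu=(K+1,1^L)$ is the hook-shaped partition of $n=K+L+1$ with one part $K+1$ and $L$ parts $1$. Drawings with crosses (the set ${\cal D}$). There are $n-1=K+L$ places numbered $1,\dots,n-1$ from left to right along an axis. A drawing puts at each place one column: $K$ of the places carry a $y$-column (above the axis) and the other $L$ places carry an $x$-column (below the axis), the two types being interleaved in any way. From left to right the $y$-columns have heights $K,K-1,\dots,1$ and the $x$-columns have depths $L,L-1,\dots,1$ (a column of height or depth $h$ consists of $h$ cells). Each cell either contains a cross or is white; only the number of crosses in each column matters, i.e. two drawings with the same columns and the same number of crosses in each column are identified. The numbers of crosses are subject to: (1) in an $x$-column the number of crosses is arbitrary (between $0$ and its depth); (2) for a $y$-column with no $x$-column to its right, the number of crosses is arbitrary (between $0$ and its height). For a $y$-column having an $x$-column to its right, consider the first (nearest) $x$-column to its right which is uniform, meaning all its cells are crossed or all its cells are white (it exists, since the $x$-column of depth $1$ is uniform): if that $x$-column is all white, the $y$-column must contain at least one cross; if it is all crossed, the $y$-column must contain at least one white cell. ${\cal D}$ is the set of all drawings with crosses satisfying these rules. *)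

theory Defs
  imports Main
begin

text \<open>
  A drawing is the list of its columns from left to right (so place \<open>i\<close> on the axis is list
  index \<open>i - 1\<close>).  Since only the number of crosses in a column matters, a column is given by its
  type and its number of crosses.
\<close>

datatype column = is_XCol: XCol (crosses: nat) | is_YCol: YCol (crosses: nat)

type_synonym drawing = "column list"

definition is_x :: "drawing \<Rightarrow> nat \<Rightarrow> bool" where
  "is_x d i \<longleftrightarrow> i < length d \<and> is_XCol (d ! i)"

definition is_y :: "drawing \<Rightarrow> nat \<Rightarrow> bool" where
  "is_y d i \<longleftrightarrow> i < length d \<and> is_YCol (d ! i)"

text \<open>
  Each type of column has heights (depths) decreasing by one from left to right down to \<open>1\<close>, so
  the height of a column is the number of columns of its type weakly to its right.
\<close>

definition height :: "drawing \<Rightarrow> nat \<Rightarrow> nat" where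
  "height d i =
     (if is_x d i then card {j. i \<le> j \<and> is_x d j} else card {j. i \<le> j \<and> is_y d j})"

definition all_white :: "drawing \<Rightarrow> nat \<Rightarrow> bool" where
  "all_white d i \<longleftrightarrow> crosses (d ! i) = 0"

definition all_crossed :: "drawing \<Rightarrow> nat \<Rightarrow> bool" where
  "all_crossed d i \<longleftrightarrow> crosses (d ! i) = height d i"

definition uniform_x :: "drawing \<Rightarrow> nat \<Rightarrow> bool" where
  "uniform_x d j \<longleftrightarrow> is_x d j \<and> (all_white d j \<or> all_crossed d j)"

definition first_uniform_x :: "drawing \<Rightarrow> nat \<Rightarrow> nat \<Rightarrow> bool" where
  "first_uniform_x d i j \<longleftrightarrow>
     i < j \<and> uniform_x d j \<and> (\<forall>k. i < k \<and> k < j \<longrightarrow> \<not> uniform_x d k)"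

text \<open>
  The last two conditions are vacuous for a \<open>y\<close>-column with no \<open>x\<close>-column to its right; for the
  others, see lemma \<open>first_uniform_x_exists\<close> below.
\<close>

definition valid_drawing :: "drawing \<Rightarrow> bool" where
  "valid_drawing d \<longleftrightarrow>
     (\<forall>i < length d. crosses (d ! i) \<le> height d i) \<and>
     (\<forall>i j. is_y d i \<and> first_uniform_x d i j \<and> all_white d j \<longrightarrow> \<not> all_white d i) \<and>
     (\<forall>i j. is_y d i \<and> first_uniform_x d i j \<and> all_crossed d j \<longrightarrow> \<not> all_crossed d i)"

definition drawings :: "nat \<Rightarrow> nat \<Rightarrow> drawing set" where
  "drawings K L =
     {d. card {i. is_y d i} = K \<and> card {i. is_x d i} = L \<and> valid_drawing d}"

lemma finite_is_x: "finite {j. is_x d j}"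
  by (rule finite_subset[of _ "{..<length d}"]) (auto simp: is_x_def)

lemma first_uniform_x_exists:
  assumes d: "valid_drawing d" and m: "is_x d m" "i < m"
  shows "\<exists>!j. first_uniform_x d i j"
proof -
  define r where "r = Max {j. is_x d j}"
  have r: "is_x d r" "m \<le> r" "\<And>j. is_x d j \<Longrightarrow> j \<le> r"
    using Max_in[OF finite_is_x, of d] Max_ge[OF finite_is_x, of _ d] m by (auto simp: r_def)
  have "{j. r \<le> j \<and> is_x d j} = {r}"
    using r by force
  then have "height d r = 1"
    using r(1) by (simp add: height_def)
  moreover have "crosses (d ! r) \<le> height d r"
    using d r(1) by (auto simp: valid_drawing_def is_x_def)
  ultimately have "uniform_x d r"
    using r(1) by (auto simp: uniform_x_def all_white_def all_crossed_def)
  then have P: "i < r \<and> uniform_x d r"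
    using r(2) m(2) by simp
  have "first_uniform_x d i (LEAST j. i < j \<and> uniform_x d j)"
    unfolding first_uniform_x_def
    using LeastI[of "\<lambda>j. i < j \<and> uniform_x d j", OF P]
      not_less_Least[of _ "\<lambda>j. i < j \<and> uniform_x d j"] by blast
  moreover have "j = k" if "first_uniform_x d i j" "first_uniform_x d i k" for j k
    using that unfolding first_uniform_x_def by (meson linorder_neqE_nat)
  ultimately show ?thesis by blast
qed

end

theory Submission
  imports Defs
begin

text \<open>
  The count is obtained by reading a drawing from right to left, i.e. by prepending columns.
  Heights, uniformity and the rules for a column depend only on that column and on what stands to
  its right, so prepending a column never disturbs the columns already drawn
  (\<open>valid_drawing_Cons\<close>).  On a drawing with \<open>K\<close> \<open>y\<close>-columns and \<open>L\<close> \<open>x\<close>-columns, a new \<open>x\<close>-column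
  has depth \<open>L + 1\<close> and may receive any of \<open>L + 2\<close> numbers of crosses.  A new \<open>y\<close>-column has height
  \<open>K + 1\<close>; if \<open>L = 0\<close> all \<open>K + 2\<close> numbers are possible, while if \<open>L > 0\<close> exactly one of the two
  extreme numbers \<open>0\<close> and \<open>K + 1\<close> is forbidden.  Which one depends on the nearest uniform
  \<open>x\<close>-column, but the number of choices, \<open>K + 1\<close>, does not.

  Sorting drawings by their leftmost column, the cardinality \<open>a(K, L)\<close> thus satisfies
  \<open>a(K, L) = (L + 1) a(K, L - 1) + K a(K - 1, L)\<close> for \<open>L > 0\<close>, and
  \<open>a(K, 0) = (K + 1) a(K - 1, 0)\<close>.  If both smaller cardinalities are \<open>(K + L)!\<close>, the coefficients
  add up to \<open>K + L + 1\<close>, and the factorial follows.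
\<close>

section \<open>Prepending a column\<close>

lemma finite_is_y: "finite {j. is_y d j}"
  by (rule finite_subset[of _ "{..<length d}"]) (auto simp: is_y_def)

lemma is_x_Cons: "is_x (c # d) j \<longleftrightarrow> (case j of 0 \<Rightarrow> is_XCol c | Suc i \<Rightarrow> is_x d i)"
  by (cases j) (auto simp: is_x_def)

lemma is_y_Cons: "is_y (c # d) j \<longleftrightarrow> (case j of 0 \<Rightarrow> is_YCol c | Suc i \<Rightarrow> is_y d i)"
  by (cases j) (auto simp: is_y_def)

lemma card_shift:
  assumes "finite {i. P (Suc i)}"
  shows "card {j :: nat. P j} = (if P 0 then Suc (card {i. P (Suc i)}) else card {i. P (Suc i)})"
proof -
  have "{j. P j} = (if P 0 then insert 0 (Suc ` {i. P (Suc i)}) else Suc ` {i. P (Suc i)})"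
    by (auto simp: image_iff) (metis not0_implies_Suc)+
  then show ?thesis
    using assms by (simp add: card_image)
qed

lemma card_x_Cons:
  "card {j. is_x (c # d) j} = (if is_XCol c then Suc (card {j. is_x d j}) else card {j. is_x d j})"
  using card_shift[of "is_x (c # d)"] by (simp add: is_x_Cons finite_is_x)

lemma card_y_Cons:
  "card {j. is_y (c # d) j} = (if is_YCol c then Suc (card {j. is_y d j}) else card {j. is_y d j})"
  using card_shift[of "is_y (c # d)"] by (simp add: is_y_Cons finite_is_y)

lemma height_Cons_0:
  "height (c # d) 0 =
     (if is_XCol c then Suc (card {j. is_x d j}) else Suc (card {j. is_y d j}))"
  using card_x_Cons[of c d] card_y_Cons[of c d]
  by (cases c) (simp_all add: height_def is_x_Cons[of _ _ 0])

lemma height_Cons_Suc: "height (c # d) (Suc i) = height d i"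
proof -
  have "card {j. Suc i \<le> j \<and> is_x (c # d) j} = card {j. i \<le> j \<and> is_x d j}"
    using card_shift[of "\<lambda>j. Suc i \<le> j \<and> is_x (c # d) j"]
    by (simp add: is_x_Cons finite_is_x)
  moreover have "card {j. Suc i \<le> j \<and> is_y (c # d) j} = card {j. i \<le> j \<and> is_y d j}"
    using card_shift[of "\<lambda>j. Suc i \<le> j \<and> is_y (c # d) j"]
    by (simp add: is_y_Cons finite_is_y)
  ultimately show ?thesis
    by (simp add: height_def is_x_Cons)
qed

lemma all_white_Cons_Suc: "all_white (c # d) (Suc i) \<longleftrightarrow> all_white d i"
  by (simp add: all_white_def)

lemma all_crossed_Cons_Suc: "all_crossed (c # d) (Suc i) \<longleftrightarrow> all_crossed d i"
  by (simp add: all_crossed_def height_Cons_Suc)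

lemma uniform_x_Cons_Suc: "uniform_x (c # d) (Suc i) \<longleftrightarrow> uniform_x d i"
  by (simp add: uniform_x_def is_x_Cons all_white_Cons_Suc all_crossed_Cons_Suc)

lemma all_nat_0_Suc: "(\<forall>i. P i) \<longleftrightarrow> P 0 \<and> (\<forall>i. P (Suc i))"
  by (metis not0_implies_Suc)

lemma first_uniform_x_Cons_Suc:
  "first_uniform_x (c # d) (Suc i) (Suc j) \<longleftrightarrow> first_uniform_x d i j"
  by (simp add: first_uniform_x_def uniform_x_Cons_Suc
      all_nat_0_Suc[where P = "\<lambda>k. Suc i < k \<and> k < Suc j \<longrightarrow> \<not> uniform_x (c # d) k"])

text \<open>
  The column that decides the rule for a \<open>y\<close>-column prepended to \<open>d\<close>.  It is determined by \<open>d\<close>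
  alone, so the possible contents of the new column can be discussed before choosing one.
\<close>

definition leftmost_uniform_x :: "drawing \<Rightarrow> nat \<Rightarrow> bool" where
  "leftmost_uniform_x d j \<longleftrightarrow> uniform_x d j \<and> (\<forall>k<j. \<not> uniform_x d k)"

lemma first_uniform_x_Cons_0:
  "first_uniform_x (c # d) 0 (Suc j) \<longleftrightarrow> leftmost_uniform_x d j"
  by (simp add: first_uniform_x_def leftmost_uniform_x_def uniform_x_Cons_Suc
      all_nat_0_Suc[where P = "\<lambda>k. 0 < k \<and> k < Suc j \<longrightarrow> \<not> uniform_x (c # d) k"])

lemma not_first_uniform_x_0: "\<not> first_uniform_x d i 0"
  by (simp add: first_uniform_x_def)

text \<open>
  Every rule looks only to the right, so the rules for \<open>c # d\<close> split into those for \<open>d\<close> and those for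
  the new column.  This is what turns the count into a recursion.
\<close>

lemma valid_drawing_Cons:
  "valid_drawing (c # d) \<longleftrightarrow>
     valid_drawing d \<and> crosses c \<le> height (c # d) 0 \<and>
     (is_YCol c \<longrightarrow> (\<forall>j. leftmost_uniform_x d j \<longrightarrow>
        (all_white d j \<longrightarrow> crosses c \<noteq> 0) \<and>
        (all_crossed d j \<longrightarrow> crosses c \<noteq> height (c # d) 0)))"
proof -
  have bound: "(\<forall>i < length (c # d). crosses ((c # d) ! i) \<le> height (c # d) i) \<longleftrightarrow>
      crosses c \<le> height (c # d) 0 \<and> (\<forall>i < length d. crosses (d ! i) \<le> height d i)"
    by (simp add: All_less_Suc2 height_Cons_Suc)
  \<comment> \<open>The rules for white and for crossed columns have the same shape, with \<open>P\<close> as the colour.\<close>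
  have split: "(\<forall>i j. is_y (c # d) i \<and> first_uniform_x (c # d) i j \<and> P (c # d) j \<longrightarrow> \<not> P (c # d) i) \<longleftrightarrow>
      (is_YCol c \<longrightarrow> (\<forall>j. leftmost_uniform_x d j \<longrightarrow> P d j \<longrightarrow> \<not> P (c # d) 0)) \<and>
      (\<forall>i j. is_y d i \<and> first_uniform_x d i j \<and> P d j \<longrightarrow> \<not> P d i)"
    if P: "\<And>i. P (c # d) (Suc i) = P d i" for P
    by (subst (1 2) all_nat_0_Suc)
      (simp add: all_nat_0_Suc[where P = "\<lambda>j. first_uniform_x (c # d) (Suc _) j \<and> P (c # d) j \<longrightarrow> _ j"]
        is_y_Cons P first_uniform_x_Cons_Suc first_uniform_x_Cons_0 not_first_uniform_x_0, blast)
  show ?thesis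
    unfolding valid_drawing_def bound
      split[of all_white, OF all_white_Cons_Suc] split[of all_crossed, OF all_crossed_Cons_Suc]
    by (auto simp: all_white_def all_crossed_def)
qed

section \<open>Counting the choices for the new column\<close>

lemma leftmost_uniform_x_exists:
  assumes "valid_drawing d" "card {j. is_x d j} > 0"
  shows "\<exists>!j. leftmost_uniform_x d j"
proof -
  obtain m where "is_x d m"
    using assms(2) by (metis card.empty empty_Collect_eq less_irrefl)
  \<comment> \<open>An \<open>x\<close>-column in front is subject to no rule and serves as a point to the left of all of \<open>d\<close>.\<close>
  moreover have "valid_drawing (XCol 0 # d)"
    using assms(1) by (simp add: valid_drawing_Cons)
  ultimately have "\<exists>!j. first_uniform_x (XCol 0 # d) 0 j"
    using first_uniform_x_exists[of "XCol 0 # d" "Suc m" 0] by (simp add: is_x_Cons)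
  then obtain j where j: "first_uniform_x (XCol 0 # d) 0 j"
    "\<And>i. first_uniform_x (XCol 0 # d) 0 i \<Longrightarrow> i = j"
    by blast
  then obtain j' where "j = Suc j'"
    using not_first_uniform_x_0 by (metis not0_implies_Suc)
  with j show ?thesis
    by (metis first_uniform_x_Cons_0 nat.inject)
qed

text \<open>
  Were a column of depth \<open>0\<close> possible, it would be both white and crossed and would forbid two
  values at once; the column itself counts towards its depth, which rules this out.
\<close>

lemma not_white_and_crossed:
  assumes "uniform_x d j"
  shows "\<not> (all_white d j \<and> all_crossed d j)"
proof -
  have "{i. j \<le> i \<and> is_x d i} \<noteq> {}" "finite {i. j \<le> i \<and> is_x d i}"
    using assms by (auto simp: uniform_x_def is_x_def)
  then have "height d j > 0"
    using assms by (simp add: height_def uniform_x_def card_gt_0_iff)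
  then show ?thesis
    by (auto simp: all_white_def all_crossed_def)
qed

lemma card_x_choices:
  assumes "valid_drawing d" "card {j. is_x d j} = L"
  shows "card {c. is_XCol c \<and> valid_drawing (c # d)} = L + 2"
proof -
  have "{c. is_XCol c \<and> valid_drawing (c # d)} = XCol ` {..Suc L}"
    using assms by (auto simp: valid_drawing_Cons height_Cons_0 image_iff is_XCol_def)
  then show ?thesis
    by (simp add: card_image inj_on_def)
qed

lemma card_y_choices_free:
  assumes "valid_drawing d" "card {j. is_y d j} = K" "card {j. is_x d j} = 0"
  shows "card {c. is_YCol c \<and> valid_drawing (c # d)} = K + 2"
proof -
  have "\<not> leftmost_uniform_x d j" for j
    using assms(3) finite_is_x by (auto simp: leftmost_uniform_x_def uniform_x_def)
  then have "{c. is_YCol c \<and> valid_drawing (c # d)} = YCol ` {..Suc K}"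
    using assms by (auto simp: valid_drawing_Cons height_Cons_0 image_iff is_YCol_def)
  then show ?thesis
    by (simp add: card_image inj_on_def)
qed

text \<open>
  The key point of the count: a uniform column forbids \<open>0\<close> crosses or \<open>K + 1\<close> crosses according to
  its colour, but in either case exactly one value.
\<close>

lemma card_y_choices_restricted:
  assumes "valid_drawing d" "card {j. is_y d j} = K" "card {j. is_x d j} > 0"
  shows "card {c. is_YCol c \<and> valid_drawing (c # d)} = K + 1"
proof -
  obtain j where j: "leftmost_uniform_x d j" "\<And>i. leftmost_uniform_x d i \<longleftrightarrow> i = j"
    using leftmost_uniform_x_exists[OF assms(1,3)] by blast
  define forbidden where "forbidden = (if all_white d j then 0 else Suc K)"
  have "all_white d j \<longleftrightarrow> \<not> all_crossed d j"
    using j(1) not_white_and_crossed[of d j] by (auto simp: leftmost_uniform_x_def uniform_x_def)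
  then have "{c. is_YCol c \<and> valid_drawing (c # d)} = YCol ` ({..Suc K} - {forbidden})"
    using assms j(2)
    by (auto simp: valid_drawing_Cons height_Cons_0 image_iff is_YCol_def forbidden_def)
  moreover have "forbidden \<in> {..Suc K}"
    by (simp add: forbidden_def)
  ultimately show ?thesis
    by (simp add: card_image inj_on_def)
qed

section \<open>The recursion\<close>

definition prepend :: "(column \<Rightarrow> bool) \<Rightarrow> drawing set \<Rightarrow> drawing set" where
  "prepend T A = {c # d | c d. d \<in> A \<and> T c \<and> valid_drawing (c # d)}"

text \<open>
  Since infinite sets have cardinality \<open>0\<close>, the assumption \<open>m > 0\<close> also says that each drawing has
  finitely many extensions.
\<close>

lemma card_prepend:
  assumes "finite A" "m > 0"
    and "\<And>d. d \<in> A \<Longrightarrow> card {c. T c \<and> valid_drawing (c # d)} = m"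
  shows "finite (prepend T A) \<and> card (prepend T A) = m * card A"
proof -
  define S where "S = (SIGMA d:A. {c. T c \<and> valid_drawing (c # d)})"
  have eq: "prepend T A = (\<lambda>(d, c). c # d) ` S"
    by (auto simp: prepend_def S_def image_iff)
  have fin: "finite {c. T c \<and> valid_drawing (c # d)}" if "d \<in> A" for d
    using assms(2) assms(3)[OF that] by (simp add: card_ge_0_finite)
  have "finite S"
    using assms(1) fin by (auto simp: S_def)
  moreover have "card S = m * card A"
    using assms fin by (simp add: S_def)
  moreover have "inj_on (\<lambda>(d, c). c # d) S"
    by (auto simp: inj_on_def)
  ultimately show ?thesis
    by (simp add: eq card_image)
qed

lemma drawings_Cons_x:
  assumes "is_XCol c"
  shows "c # d \<in> drawings K L \<longleftrightarrow>
    (\<exists>L'. L = Suc L' \<and> d \<in> drawings K L') \<and> valid_drawing (c # d)"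
  using assms by (auto simp: drawings_def card_x_Cons card_y_Cons valid_drawing_Cons is_XCol_def)

lemma drawings_Cons_y:
  assumes "is_YCol c"
  shows "c # d \<in> drawings K L \<longleftrightarrow>
    (\<exists>K'. K = Suc K' \<and> d \<in> drawings K' L) \<and> valid_drawing (c # d)"
  using assms by (auto simp: drawings_def card_x_Cons card_y_Cons valid_drawing_Cons is_YCol_def)

lemma drawings_Nil: "[] \<in> drawings K L \<longleftrightarrow> K = 0 \<and> L = 0"
  by (auto simp: drawings_def valid_drawing_def is_x_def is_y_def)

lemma drawings_rec:
  "drawings K L =
     (if K = 0 \<and> L = 0 then {[]} else {}) \<union>
     (if L = 0 then {} else prepend is_XCol (drawings K (L - 1))) \<union>
     (if K = 0 then {} else prepend is_YCol (drawings (K - 1) L))"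
  (is "_ = ?R")
proof (rule set_eqI)
  fix d
  show "d \<in> drawings K L \<longleftrightarrow> d \<in> ?R"
  proof (cases d)
    case Nil
    then show ?thesis
      by (simp add: drawings_Nil prepend_def)
  next
    case (Cons c e)
    then show ?thesis
      by (cases c; cases K; cases L) (auto simp: drawings_Cons_x drawings_Cons_y prepend_def)
  qed
qed

lemma card_prepend_x:
  assumes "finite (drawings K L)"
  shows "finite (prepend is_XCol (drawings K L)) \<and>
    card (prepend is_XCol (drawings K L)) = (L + 2) * card (drawings K L)"
  by (rule card_prepend[OF assms]) (auto simp: drawings_def card_x_choices)

lemma card_prepend_y:
  assumes "finite (drawings K L)"
  shows "finite (prepend is_YCol (drawings K L)) \<and>
    card (prepend is_YCol (drawings K L)) = (if L = 0 then K + 2 else K + 1) * card (drawings K L)"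
  by (rule card_prepend[OF assms])
    (auto simp: drawings_def card_y_choices_free card_y_choices_restricted)

lemma card_drawings:
  "finite (drawings K L) \<and> card (drawings K L) = fact (K + L + 1)"
proof (induction "K + L" arbitrary: K L rule: less_induct)
  case less
  have X: "finite (prepend is_XCol (drawings K (L - 1))) \<and>
      card (prepend is_XCol (drawings K (L - 1))) = (L + 1) * fact (K + L)" if "L > 0"
    using less[of K "L - 1"] card_prepend_x[of K "L - 1"] that by (cases L) auto
  have Y: "finite (prepend is_YCol (drawings (K - 1) L)) \<and>
      card (prepend is_YCol (drawings (K - 1) L)) = (if L = 0 then K + 1 else K) * fact (K + L)"
    if "K > 0"
    using less[of "K - 1" L] card_prepend_y[of "K - 1" L] that by (cases K) auto
  have disj: "prepend is_XCol A \<inter> prepend is_YCol B = {}" for A B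
    by (auto simp: prepend_def)
  show ?case
  proof (cases "K = 0"; cases "L = 0")
    assume "K = 0" "L = 0"
    then show ?thesis
      by (simp add: drawings_rec[of 0 0])
  next
    assume "K = 0" "L \<noteq> 0"
    then show ?thesis
      using X by (simp add: drawings_rec[of 0 L])
  next
    assume "K \<noteq> 0" "L = 0"
    then show ?thesis
      using Y by (simp add: drawings_rec[of K 0])
  next
    assume KL: "K \<noteq> 0" "L \<noteq> 0"
    then have "card (drawings K L) = (L + 1) * fact (K + L) + K * fact (K + L)"
      using X Y disj by (simp add: drawings_rec[of K L] card_Un_disjoint)
    also have "\<dots> = fact (K + L + 1)"
      by (simp add: algebra_simps)
    finally show ?thesis
      using KL X Y by (simp add: drawings_rec[of K L])
  qed
qed

theorem mainTheorem1:
  fixes K L n :: nat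
  assumes "n = K + L + 1"
  shows "card (drawings K L) = fact n"
  using card_drawings assms by simp

end
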